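(* Let $A$ be a nonzero real symmetric $n\times n$ matrix with rank $r(A)$, $\underline{\boldsymbol{x}}\sim N(\underline 0,I_n)$ and $\boldsymbol{\Delta}=\underline{\boldsymbol{x}}^{\mathsf T}A\underline{\boldsymbol{x}}-\mathrm{tr}(A)$. Then for every $t>0$, $$\Pr(\boldsymbol{\Delta}>t)\le\liminf_{m\to\infty}\inf_{0<b<1}e^{\Lambda_m(t,b)}\le\Big(1+\frac{t}{r(A)\|A\|}\Big)^{\frac{r(A)}{2}}e^{-\frac{t}{2\|A\|}}.$$
   Context: For integers $m\ge1$ and $0<b<1$, $$\theta_m(b)=-\frac{1}{b^{m+1}}\Big(\ln(1-b)+b+\frac{b^2}{2}+\cdots+\frac{b^m}{m}\Big),\qquad \kappa_m(b)=\frac{m}{2(m+1)}\min\Big\{\frac{1}{((m+1)\theta_m(b))^{1/m}},b\Big\},$$ $$\Lambda_m(t,b)=\frac{r(A)}{2}\sum_{k=2}^m\frac{b^k}{k}-\kappa_m(b)\min\Big\{\frac{t^{1+\frac1m}}{\|A\|_{m+1}^{1+\frac1m}},\frac{t}{\|A\|}\Big\}.$$ Here $\|A\|=\max_i|\lambda_i|$ is the operator norm and $\|A\|_p=(\sum_i|\lambda_i|^p)^{1/p}$ is the Schatten $p$-norm, where $\lambda_i$ are the eigenvalues of $A$. *)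

theory Defs
  imports "HOL-Probability.Probability" "HOL-Computational_Algebra.Polynomial"
begin

definition charpoly :: "real^'n^'n \<Rightarrow> real poly" where
  "charpoly A = det (mat [:0, 1:] - map_matrix (\<lambda>a. [:a:]) A)"

(* The real eigenvalues, repeated according to algebraic multiplicity.  For a symmetric
   matrix these are all eigenvalues, so the multiset has exactly CARD('n) elements. *)
definition eigenvalues :: "real^'n^'n \<Rightarrow> real multiset" where
  "eigenvalues A = proots (charpoly A)"

(* Meaningful for symmetric matrices only: in general the singular values would have to
   replace the absolute values of the eigenvalues. *)
definition schatten_norm :: "real \<Rightarrow> real^'n^'n \<Rightarrow> real" where
  "schatten_norm p A = (\<Sum>l\<in>#eigenvalues A. \<bar>l\<bar> powr p) powr (1 / p)"

(* For symmetric A this is the largest absolute value of an eigenvalue. *)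
definition op_norm :: "real^'n^'n \<Rightarrow> real" where
  "op_norm A = onorm (\<lambda>v. A *v v)"

(* X is N(0, I)-distributed under M: its Lebesgue density is the product of
   standard normal densities in the coordinates. *)
definition std_normal_vector :: "'a measure \<Rightarrow> ('a \<Rightarrow> real^'n) \<Rightarrow> bool" where
  "std_normal_vector M X \<longleftrightarrow>
     distributed M lborel X (\<lambda>v. ennreal (\<Prod>i\<in>UNIV. std_normal_density (v $ i)))"

definition theta :: "nat \<Rightarrow> real \<Rightarrow> real" where
  "theta m b = - (1 / b ^ (m + 1)) * (ln (1 - b) + (\<Sum>k=1..m. b ^ k / real k))"

definition kappa :: "nat \<Rightarrow> real \<Rightarrow> real" where
  "kappa m b = real m / (2 * (real m + 1)) *
     min (1 / ((real m + 1) * theta m b) powr (1 / real m)) b"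

definition Lambda :: "real^'n^'n \<Rightarrow> nat \<Rightarrow> real \<Rightarrow> real \<Rightarrow> real" where
  "Lambda A m t b = real (rank A) / 2 * (\<Sum>k=2..m. b ^ k / real k) -
     kappa m b *
       min (t powr (1 + 1 / real m) / schatten_norm (real m + 1) A powr (1 + 1 / real m))
           (t / op_norm A)"

end

theory Submission
  imports Defs "HOL-Real_Asymp.Real_Asymp"
begin

text \<open>
  Rotating by an orthogonal matrix of eigenvectors turns the quadratic form into
  $\Delta = \sum_i \lambda_i (y_i^2 - 1)$ with independent standard normal $y_i$, because
  a standard normal density depends on the norm only and Lebesgue measure is invariant under
  rotations.  Hence, as long as $u \lambda_i < 1$ for every $i$,
  $$\ln E e^{u \Delta / 2} = \frac12 \sum_i \bigl(-\ln(1 - u\lambda_i) - u\lambda_i\bigr),$$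
  and the exponential Markov inequality bounds the tail by the exponential of this quantity
  minus $u t / 2$.

  For a fixed truncation order $m$ and $|x| \le b < 1$, the power series of the logarithm gives
  $-\ln(1-x) - x \le \sum_{k=2}^m b^k/k + |x|^{m+1} \theta_m(b)$, because $\theta_m(b)$ is the sum
  of the series $\sum_k b^k/(k+m+1)$.  With $x = u \lambda_i$, and with the zero eigenvalues
  contributing nothing, the exponent becomes at most
  $$\frac{r(A)}2 \sum_{k=2}^m \frac{b^k}{k}
    + \frac12 \theta_m(b)\, u^{m+1} \|A\|_{m+1}^{m+1} - \frac12 ut.$$
  Take for $u$ the unconstrained minimizer of the last two terms, capped at $b / \|A\|$.  Up to
  that minimizer, the term with $u^{m+1}$ is at most $1/(m+1)$ of the linear one, so together they
  are at most $-\frac{m}{2(m+1)} u t$, and this is at most the second term of $\Lambda_m(t,b)$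
  (lemma \<open>tail_le_exp_Lambda\<close>).  So every $m \ge 1$ and every $b$ give a valid tail bound,
  whence the first inequality.

  For the second inequality a single $b$ suffices.  As $m \to \infty$, the Schatten norm tends to
  the operator norm and $((m+1)\theta_m(b))^{1/m}$ to 1, so that $\Lambda_m(t,b)$
  tends to $\frac{r}{2}(-\ln(1-b) - b) - \frac{bt}{2\|A\|}$, where $r = r(A)$.  The proof follows
  an explicit upper bound of $\Lambda_m(t,b)$ with this limit (lemmas \<open>Lambda_le\<close> and
  \<open>exp_Lambda_bound_limit\<close>).
  The limit is minimal at $b = t / (r\|A\| + t)$, where its exponential is the
  right-hand side of the claim.
\<close>

section \<open>Diagonalizing a real symmetric matrix\<close>

text \<open>
  Write \<open>c\<close> for the maximum.  The quadratic form of \<open>c - f\<close> is nonnegative on \<open>S\<close> and vanishes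
  at \<open>v\<close>, so along every line through \<open>v\<close> its linear coefficient must vanish; in the direction
  \<open>w = f v - c v\<close> this coefficient is \<open>- 2 * (w \<bullet> w)\<close>.
\<close>

lemma rayleigh_maximizer_is_eigenvector:
  fixes f :: "'a::euclidean_space \<Rightarrow> 'a"
  assumes f: "linear f" and sym: "\<And>x y. f x \<bullet> y = x \<bullet> f y"
    and S: "subspace S" and inv: "\<And>x. x \<in> S \<Longrightarrow> f x \<in> S"
    and v: "v \<in> S" "norm v = 1"
    and vmax: "\<And>x. \<lbrakk>x \<in> S; norm x = 1\<rbrakk> \<Longrightarrow> x \<bullet> f x \<le> v \<bullet> f v"
  shows "f v = (v \<bullet> f v) *\<^sub>R v"
proof -
  define c where "c = v \<bullet> f v"
  have q: "0 \<le> c * (x \<bullet> x) - x \<bullet> f x" if "x \<in> S" for x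
  proof (cases "x = 0")
    case True
    then show ?thesis by simp
  next
    case False
    define y where "y = x /\<^sub>R norm x"
    have "y \<bullet> f y \<le> c"
      unfolding c_def y_def using that S False by (intro vmax subspace_scale) auto
    moreover have "x = norm x *\<^sub>R y"
      using False by (simp add: y_def)
    then have "x \<bullet> f x = (norm x)\<^sup>2 * (y \<bullet> f y)"
      by (metis f linear_cmul inner_scaleR_left inner_scaleR_right mult.assoc power2_eq_square)
    ultimately show ?thesis
      using mult_left_mono[of "y \<bullet> f y" c "x \<bullet> x"] by (simp add: power2_norm_eq_inner mult.commute)
  qed
  define w where "w = f v - c *\<^sub>R v"
  have wS: "w \<in> S"
    unfolding w_def using S v inv by (intro subspace_diff subspace_scale) auto
  have vv: "v \<bullet> v = 1"
    using v by (simp add: norm_eq_1)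
  have quad: "0 \<le> s\<^sup>2 * (c * (w \<bullet> w) - w \<bullet> f w) - 2 * s * (w \<bullet> w)" for s
  proof -
    have "0 \<le> c * ((v + s *\<^sub>R w) \<bullet> (v + s *\<^sub>R w)) - (v + s *\<^sub>R w) \<bullet> f (v + s *\<^sub>R w)"
      using S v wS by (intro q subspace_add subspace_scale) auto
    also have "\<dots> = s\<^sup>2 * (c * (w \<bullet> w) - w \<bullet> f w) - 2 * s * (w \<bullet> f v - c * (v \<bullet> w))"
      using sym[of v w]
      by (simp add: linear_add[OF f] linear_cmul[OF f] inner_add_left inner_add_right vv
          inner_commute power2_eq_square c_def algebra_simps)
    also have "w \<bullet> f v - c * (v \<bullet> w) = w \<bullet> w"
      by (simp add: w_def inner_diff_left inner_diff_right inner_commute algebra_simps)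
    finally show ?thesis .
  qed
  have "w \<bullet> w = 0"
  proof (rule ccontr)
    define a where "a = w \<bullet> w"
    define K where "K = c * (w \<bullet> w) - w \<bullet> f w"
    assume "w \<bullet> w \<noteq> 0"
    then have a: "a > 0" by (simp add: a_def)
    have K: "K \<ge> 0" unfolding K_def by (rule q[OF wS])
    \<comment> \<open>a step so small that the linear term beats the quadratic one; the summand 1 avoids division by zero\<close>
    define s where "s = a / (K + 1)"
    have s: "s > 0" using a K by (simp add: s_def)
    have "s * K < 2 * a"
    proof -
      have "s * K \<le> s * (K + 1)" using s by simp
      also have "\<dots> = a" using K by (simp add: s_def)
      finally show ?thesis using a by simp
    qed
    then have "s * (s * K) < s * (2 * a)" using s by simp
    with quad[of s] show False
      by (simp add: a_def K_def power2_eq_square mult_ac)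
  qed
  then show ?thesis by (simp add: w_def c_def)
qed

text \<open>
  Split off one eigenvector, found by maximizing the quadratic form on the compact unit sphere
  of \<open>S\<close>.  Its orthogonal complement in \<open>S\<close> is again invariant and has one dimension less.
\<close>

lemma self_adjoint_orthonormal_eigenbasis:
  fixes f :: "'a::euclidean_space \<Rightarrow> 'a"
  assumes f: "linear f" and sym: "\<And>x y. f x \<bullet> y = x \<bullet> f y"
    and S: "subspace S" and inv: "\<And>x. x \<in> S \<Longrightarrow> f x \<in> S"
  shows "\<exists>B. B \<subseteq> S \<and> finite B \<and> card B = dim S \<and> pairwise orthogonal B
           \<and> (\<forall>x\<in>B. norm x = 1) \<and> (\<forall>x\<in>B. \<exists>c. f x = c *\<^sub>R x)"
  using S inv
proof (induction "dim S" arbitrary: S)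
  case 0
  then show ?case by (intro exI[of _ "{}"]) auto
next
  case (Suc k)
  define K where "K = S \<inter> sphere 0 1"
  have "compact K"
    unfolding K_def by (intro closed_Int_compact closed_subspace Suc.prems compact_sphere)
  moreover obtain x where "x \<in> S" "x \<noteq> 0"
  proof -
    have "\<not> S \<subseteq> {0}"
    proof
      assume "S \<subseteq> {0}"
      then have "dim S = 0" by (rule dim_eq_0[THEN iffD2])
      with Suc.hyps(2) show False by simp
    qed
    then show ?thesis using that by blast
  qed
  then have "x /\<^sub>R norm x \<in> K"
    using Suc.prems(1) by (simp add: K_def subspace_scale)
  then have "K \<noteq> {}" by blast
  moreover have "continuous_on K (\<lambda>x. x \<bullet> f x)"
    by (intro continuous_intros linear_continuous_on linear_conv_bounded_linear[THEN iffD1] f)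
  ultimately obtain v where v: "v \<in> K" "\<And>x. x \<in> K \<Longrightarrow> x \<bullet> f x \<le> v \<bullet> f v"
    by (metis continuous_attains_sup)
  then have vS: "v \<in> S" and nv: "norm v = 1" by (auto simp: K_def)
  define c where "c = v \<bullet> f v"
  have fv: "f v = c *\<^sub>R v"
    unfolding c_def
    by (rule rayleigh_maximizer_is_eigenvector[OF f sym Suc.prems])
      (use v vS nv in \<open>auto simp: K_def\<close>)
  define S' where "S' = {y \<in> S. \<forall>x \<in> span {v}. orthogonal x y}"
  have S'_iff: "y \<in> S' \<longleftrightarrow> y \<in> S \<and> v \<bullet> y = 0" for y
    by (auto simp: S'_def span_singleton orthogonal_def)
  have "subspace S'"
    using Suc.prems(1) by (auto simp: subspace_def S'_iff inner_add_right)
  have "dim S' + dim (span {v}) = dim S"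
    unfolding S'_def using vS Suc.prems(1)
    by (intro dim_subspace_orthogonal_to_vectors subspace_span span_minimal) auto
  moreover have "v \<noteq> 0" using nv by auto
  ultimately have dim: "dim S' = k"
    using Suc.hyps(2) by simp
  have "f y \<in> S'" if "y \<in> S'" for y
    using that Suc.prems(2) sym[of v y] by (simp add: S'_iff fv)
  then obtain B where B: "B \<subseteq> S'" "finite B" "card B = k" "pairwise orthogonal B"
      "\<forall>x\<in>B. norm x = 1" "\<forall>x\<in>B. \<exists>c. f x = c *\<^sub>R x"
    using Suc.hyps(1)[OF dim[symmetric] \<open>subspace S'\<close>] dim by metis
  have "v \<notin> S'" using nv by (simp add: S'_iff norm_eq_1)
  then have "card (insert v B) = dim S"
    using B Suc.hyps(2) by (metis card_insert_disjoint subsetD)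
  moreover have "pairwise orthogonal (insert v B)"
    using B(1,4) by (auto simp: pairwise_insert orthogonal_def S'_iff inner_commute)
  ultimately show ?case
    using B vS nv fv by (intro exI[of _ "insert v B"]) (auto simp: S'_iff)
qed

definition diag_matrix :: "('n \<Rightarrow> 'a::zero) \<Rightarrow> 'a^'n^'n" where
  "diag_matrix d = (\<chi> i j. if i = j then d i else 0)"

lemma diag_matrix_vec: "(diag_matrix d *v x) $ i = d i * x $ i" for d :: "'n::finite \<Rightarrow> real"
  by (simp add: diag_matrix_def matrix_vector_mult_def if_distrib [of "\<lambda>z. z * _"] cong: if_cong)

text \<open>
  The spectral theorem in matrix form: the columns of \<open>P\<close> are an orthonormal basis of
  eigenvectors.  Eigenvalues, rank, trace, quadratic form and norms are read off from this
  factorization below.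
\<close>

lemma symmetric_matrix_diagonalization:
  fixes A :: "real^'n^'n"
  assumes "transpose A = A"
  obtains P d where "orthogonal_matrix P" "A = P ** diag_matrix d ** transpose P"
proof -
  have sym: "(A *v x) \<bullet> y = x \<bullet> (A *v y)" for x y
    by (metis assms dot_lmul_matrix transpose_matrix_vector)
  obtain B where B: "finite B" "card B = CARD('n)" "pairwise orthogonal B"
      "\<forall>x\<in>B. norm x = 1" "\<forall>x\<in>B. \<exists>c. A *v x = c *\<^sub>R x"
    using self_adjoint_orthonormal_eigenbasis[of "(*v) A" UNIV] sym by auto
  then obtain p where p: "bij_betw p (UNIV :: 'n set) B"
    by (metis finite_class.finite_UNIV finite_same_card_bij)
  have pB: "p i \<in> B" for i
    using p by (auto simp: bij_betw_def)
  have "\<forall>i. \<exists>c. A *v p i = c *\<^sub>R p i"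
    using B(5) pB by blast
  then obtain d where d: "\<forall>i. A *v p i = d i *\<^sub>R p i"
    by (rule choice[THEN exE])
  define P :: "real^'n^'n" where "P = (\<chi> i j. p j $ i)"
  have col: "column j P = p j" for j
    unfolding P_def column_def by simp
  have P: "orthogonal_matrix P"
    unfolding orthogonal_matrix_orthonormal_columns col
  proof (intro conjI allI impI)
    fix i j :: 'n
    assume "i \<noteq> j"
    then have "p i \<noteq> p j"
      using p by (metis UNIV_I bij_betw_def inj_onD)
    then show "orthogonal (p i) (p j)"
      using B(3) pB by (simp add: pairwise_def)
  qed (use B(4) pB in blast)
  have "A ** P = P ** diag_matrix d"
  proof -
    have "(A ** P) $ i $ j = (P ** diag_matrix d) $ i $ j" for i j
    proof -
      have "(A ** P) $ i $ j = (A *v p j) $ i"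
        by (simp add: matrix_matrix_mult_def matrix_vector_mult_def P_def)
      also have "\<dots> = (P ** diag_matrix d) $ i $ j"
        by (simp add: d matrix_matrix_mult_def P_def diag_matrix_def
            if_distrib [of "\<lambda>z. _ * z"] cong: if_cong)
      finally show ?thesis .
    qed
    then show ?thesis by (simp add: vec_eq_iff)
  qed
  then have "A ** (P ** transpose P) = P ** diag_matrix d ** transpose P"
    by (simp add: matrix_mul_assoc)
  then have "A = P ** diag_matrix d ** transpose P"
    using P by (simp add: orthogonal_matrix_def)
  with P show thesis by (rule that)
qed

lemma map_matrix_const_mult:
  "map_matrix (\<lambda>a. [:a:]) (A ** B) = map_matrix (\<lambda>a. [:a:]) A ** map_matrix (\<lambda>a. [:a:]) B"
  for A B :: "real^'n^'n"
proof -
  have "[:(\<Sum>k\<in>UNIV. A $ i $ k * B $ k $ j):] = (\<Sum>k\<in>UNIV. [:A $ i $ k:] * [:B $ k $ j:])" for i j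
    by (simp add: poly_eq_iff coeff_sum coeff_pCons mult.commute split: nat.split)
  then show ?thesis by (simp add: vec_eq_iff matrix_matrix_mult_def del: mult_pCons_left mult_pCons_right)
qed

lemma charpoly_diag_matrix: "charpoly (diag_matrix d) = (\<Prod>i\<in>UNIV. [:- d i, 1:])"
  unfolding charpoly_def
  by (subst det_diagonal) (auto simp: mat_def diag_matrix_def intro!: prod.cong)

text \<open>
  Similar matrices have equal characteristic polynomials: the scalar matrix of the
  indeterminate commutes with the constant matrix \<open>P\<close>, so that the conjugation can be pulled
  out of the determinant.
\<close>

lemma charpoly_orthogonal_conj:
  fixes A :: "real^'n^'n"
  assumes "orthogonal_matrix P"
  shows "charpoly (P ** A ** transpose P) = charpoly A"
proof -
  let ?c = "map_matrix (\<lambda>a. [:a:]) :: real^'n^'n \<Rightarrow> real poly^'n^'n"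
  let ?X = "mat [:0, 1:] :: real poly^'n^'n"
  have 1: "?c (mat 1) = mat 1"
    by (simp add: vec_eq_iff mat_def)
  have PP: "?c P ** ?c (transpose P) = mat 1"
    using assms by (simp add: orthogonal_matrix_def 1 flip: map_matrix_const_mult)
  have X: "?c P ** ?X = ?X ** ?c P"
    by (simp add: vec_eq_iff matrix_matrix_mult_def mat_def mult.commute
          if_distrib [of "\<lambda>z. _ * z"] if_distrib [of "\<lambda>z. z * _"] cong: if_cong)
  have ml: "B ** (C - D) = B ** C - B ** D" and mr: "(C - D) ** B = C ** B - D ** B"
    for B C D :: "real poly^'n^'n"
    by (simp_all add: vec_eq_iff matrix_matrix_mult_def sum_subtractf algebra_simps)
  have "?c P ** (?X - ?c A) ** ?c (transpose P) = ?X ** (?c P ** ?c (transpose P)) - ?c (P ** A ** transpose P)"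
    by (simp add: mr ml map_matrix_const_mult X matrix_mul_assoc)
  then have "?c P ** (?X - ?c A) ** ?c (transpose P) = ?X - ?c (P ** A ** transpose P)"
    by (simp add: PP)
  then have "charpoly (P ** A ** transpose P) = det (?c P ** (?X - ?c A) ** ?c (transpose P))"
    by (simp add: charpoly_def)
  also have "\<dots> = det (?c P ** ?c (transpose P)) * det (?X - ?c A)"
    by (simp only: det_mul mult_ac)
  also have "\<dots> = charpoly A"
    by (simp add: PP charpoly_def)
  finally show ?thesis .
qed

lemma eigenvalues_orthogonal_conj_diag:
  assumes "orthogonal_matrix P"
  shows "eigenvalues (P ** diag_matrix d ** transpose P) = image_mset d (mset_set UNIV)"
proof -
  have "proots (\<Prod>i\<in>UNIV. [:- d i, 1:]) = (\<Sum>i\<in>UNIV. {#d i#})"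
    by (subst proots_prod) auto
  also have "\<dots> = image_mset d (mset_set UNIV)"
    by (simp add: sum_unfold_sum_mset image_mset.compositionality comp_def)
  finally show ?thesis
    by (simp add: eigenvalues_def charpoly_orthogonal_conj assms charpoly_diag_matrix)
qed

text \<open>
  The range is the coordinate subspace of the indices with nonzero entry.
\<close>

lemma rank_diag_matrix: "rank (diag_matrix d) = card {i. d i \<noteq> 0}" for d :: "'n::finite \<Rightarrow> real"
proof -
  have "range ((*v) (diag_matrix d)) = {x. \<forall>i. i \<notin> {i. d i \<noteq> 0} \<longrightarrow> x $ i = 0}" (is "_ = ?R")
  proof (intro set_eqI iffI)
    fix x assume "x \<in> ?R"
    then have "x = diag_matrix d *v (\<chi> i. x $ i / d i)"
      by (auto simp: vec_eq_iff diag_matrix_vec)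
    then show "x \<in> range ((*v) (diag_matrix d))" by blast
  qed (auto simp: diag_matrix_vec)
  then show ?thesis
    unfolding rank_dim_range using dim_substandard_cart[of "{i. d i \<noteq> 0}"]
    by (simp add: dim_vec_eq[symmetric])
qed

lemma rank_orthogonal_conj:
  fixes A :: "real^'n^'n"
  assumes "orthogonal_matrix P"
  shows "rank (P ** A ** transpose P) = rank A"
proof (rule antisym)
  show "rank (P ** A ** transpose P) \<le> rank A"
    using rank_mul_le_left rank_mul_le_right order_trans by blast
  have "A = transpose P ** (P ** A ** transpose P) ** P"
    using assms by (metis matrix_mul_assoc matrix_mul_lid matrix_mul_rid orthogonal_matrix_def)
  then show "rank A \<le> rank (P ** A ** transpose P)"
    by (metis rank_mul_le_left rank_mul_le_right order_trans)
qed

lemma trace_orthogonal_conj_diag: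
  fixes d :: "'n::finite \<Rightarrow> real"
  assumes "orthogonal_matrix P"
  shows "trace (P ** diag_matrix d ** transpose P) = (\<Sum>i\<in>UNIV. d i)"
proof -
  have "trace (P ** diag_matrix d ** transpose P) = trace (diag_matrix d)"
    using assms
    by (metis matrix_mul_assoc matrix_mul_lid orthogonal_matrix_def trace_mul_sym)
  then show ?thesis by (simp add: trace_def diag_matrix_def)
qed

lemma quadratic_form_orthogonal_conj_diag:
  fixes d :: "'n::finite \<Rightarrow> real"
  shows "x \<bullet> ((P ** diag_matrix d ** transpose P) *v x)
           = (\<Sum>i\<in>UNIV. d i * ((transpose P *v x) $ i)\<^sup>2)"
proof -
  have "x \<bullet> ((P ** diag_matrix d ** transpose P) *v x)
      = (transpose P *v x) \<bullet> (diag_matrix d *v (transpose P *v x))"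
    by (metis dot_lmul_matrix transpose_matrix_vector transpose_transpose matrix_vector_mul_assoc)
  then show ?thesis
    by (simp add: inner_vec_def diag_matrix_vec power2_eq_square mult_ac)
qed

lemma abs_eigenvalue_le_op_norm:
  fixes d :: "'n::finite \<Rightarrow> real"
  assumes "orthogonal_matrix P"
  shows "\<bar>d i\<bar> \<le> op_norm (P ** diag_matrix d ** transpose P)"
proof -
  let ?A = "P ** diag_matrix d ** transpose P"
  let ?v = "P *v axis i 1"
  have ot: "norm (P *v y) = norm y" for y
    using assms by (metis matrix_of_matrix_vector_mul matrix_vector_mul_linear
        orthogonal_transformation_matrix orthogonal_transformation_norm)
  have "?A *v ?v = P *v (diag_matrix d *v axis i 1)"
    using assms by (metis matrix_vector_mul_assoc matrix_mul_assoc matrix_mul_lid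
        matrix_mul_rid orthogonal_matrix_def)
  also have "diag_matrix d *v axis i 1 = d i *\<^sub>R axis i 1"
    by (auto simp: vec_eq_iff diag_matrix_vec axis_def)
  finally have "norm (?A *v ?v) = \<bar>d i\<bar>"
    by (simp add: ot)
  moreover have "norm (?A *v ?v) \<le> onorm ((*v) ?A) * norm ?v"
    by (intro onorm matrix_vector_mul_bounded_linear)
  ultimately show ?thesis by (simp add: op_norm_def ot)
qed

text \<open>
  The outer exponent cancels that of the norm up to \<open>1 / m\<close>, which is the form in which the
  Schatten norm enters the exponent of the tail bound.
\<close>

lemma schatten_norm_orthogonal_conj_diag:
  fixes d :: "'n::finite \<Rightarrow> real"
  assumes "orthogonal_matrix P" and m: "m \<ge> 1"
  shows "schatten_norm (real m + 1) (P ** diag_matrix d ** transpose P) powr (1 + 1 / real m)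
           = (\<Sum>i\<in>UNIV. \<bar>d i\<bar> ^ (m + 1)) powr (1 / real m)"
proof -
  have "\<bar>x\<bar> powr (real m + 1) = \<bar>x\<bar> ^ (m + 1)" for x :: real
    using powr_realpow'[of "\<bar>x\<bar>" "m + 1"] by (simp add: add.commute)
  moreover have "1 / (real m + 1) * (1 + 1 / real m) = 1 / real m"
    using m by (simp add: field_simps)
  ultimately show ?thesis
    unfolding schatten_norm_def eigenvalues_orthogonal_conj_diag[OF assms(1)]
    by (simp add: powr_powr image_mset.compositionality comp_def flip: sum_unfold_sum_mset)
qed

section \<open>Rotation invariance of Lebesgue measure\<close>

lemma nn_integral_lborel_shift:
  fixes a :: "'a::euclidean_space"
  assumes [measurable]: "g \<in> borel_measurable borel"
  shows "(\<integral>\<^sup>+x. g (a + x) \<partial>lborel) = (\<integral>\<^sup>+x. g x \<partial>lborel)"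
proof -
  have "(\<integral>\<^sup>+x. g x \<partial>lborel) = (\<integral>\<^sup>+x. g x \<partial>distr lborel borel ((+) a))"
    by (simp add: lborel_distr_plus)
  then show ?thesis by (simp add: nn_integral_distr)
qed

text \<open>
  The uniqueness argument for Haar measure.  Let \<open>B\<close> be the unit ball and integrate the
  indicator of \<open>f w - x \<in> B\<close>, \<open>f w \<in> A\<close> over all pairs \<open>(x, w)\<close>.  Integrating \<open>x\<close> first gives the
  measure of \<open>B\<close> times that of the preimage of \<open>A\<close>.  Shifting \<open>w\<close> by the preimage of \<open>x\<close> instead
  gives the measure of \<open>A\<close> times that of the preimage of \<open>B\<close>, which is \<open>B\<close> itself.  The
  measure of \<open>B\<close> is positive and finite and can be cancelled.
\<close>

lemma lborel_distr_orthogonal_transformation: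
  fixes f :: "'a::euclidean_space \<Rightarrow> 'a"
  assumes f: "orthogonal_transformation f"
  shows "distr lborel borel f = lborel"
proof (rule measure_eqI)
  fix A assume "A \<in> sets (distr lborel borel f)"
  then have A [measurable]: "A \<in> sets borel" by simp
  have lin: "linear f" and nf: "\<And>x. norm (f x) = norm x"
    using f by (auto simp: orthogonal_transformation)
  have fm [measurable]: "f \<in> borel_measurable borel"
    by (intro borel_measurable_continuous_onI linear_continuous_on
        linear_conv_bounded_linear[THEN iffD1] lin)
  define B :: "'a set" where "B = ball 0 1"
  have [measurable]: "B \<in> sets borel" by (simp add: B_def)
  let ?v = "\<lambda>A. emeasure lborel A"
  have shift: "(\<integral>\<^sup>+x. indicator S (a + x) \<partial>lborel) = ?v S"
    if "S \<in> sets borel" for S and a :: 'a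
    using nn_integral_lborel_shift[of "indicator S" a] that by simp
  have reflect: "indicator B (y - x) = (indicator B (- y + x) :: ennreal)" for x y
    by (auto simp: B_def indicator_def dist_norm norm_minus_commute)
  have invB: "indicator B (f y) = (indicator B y :: ennreal)" for y
    by (auto simp: B_def indicator_def nf)
  have "?v B * ?v (f -` A)
      = (\<integral>\<^sup>+w. \<integral>\<^sup>+x. indicator B (f w - x) * indicator A (f w) \<partial>lborel \<partial>lborel)"
  proof -
    have "(\<integral>\<^sup>+w. indicator A (f w) \<partial>lborel) = (\<integral>\<^sup>+w. indicator (f -` A) w \<partial>lborel)"
      by (simp add: indicator_def)
    then have "(\<integral>\<^sup>+w. indicator A (f w) \<partial>lborel) = ?v (f -` A)"
      using measurable_sets_borel[OF fm A] by simp
    moreover have "(\<integral>\<^sup>+x. indicator B (f w - x) \<partial>lborel) = ?v B" for w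
      by (simp only: reflect) (rule shift, simp)
    ultimately show ?thesis
      by (simp add: nn_integral_multc nn_integral_cmult)
  qed
  also have "\<dots> = (\<integral>\<^sup>+x. \<integral>\<^sup>+w. indicator B (f w - x) * indicator A (f w) \<partial>lborel \<partial>lborel)"
    by (rule lborel_pair.Fubini') measurable
  also have "\<dots> = (\<integral>\<^sup>+x. \<integral>\<^sup>+y. indicator B (f y) * indicator A (x + f y) \<partial>lborel \<partial>lborel)"
  proof (rule nn_integral_cong)
    fix x
    obtain z where z: "x = f z"
      using orthogonal_transformation_surj[OF f] by (metis surjD)
    show "(\<integral>\<^sup>+w. indicator B (f w - x) * indicator A (f w) \<partial>lborel)
        = (\<integral>\<^sup>+y. indicator B (f y) * indicator A (x + f y) \<partial>lborel)"
      using nn_integral_lborel_shift[of "\<lambda>w. indicator B (f w - x) * indicator A (f w)" z]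
      by (simp add: z linear_add[OF lin])
  qed
  also have "\<dots> = (\<integral>\<^sup>+y. \<integral>\<^sup>+x. indicator B (f y) * indicator A (f y + x) \<partial>lborel \<partial>lborel)"
    by (subst lborel_pair.Fubini') (simp_all add: add.commute)
  also have "\<dots> = ?v B * ?v A"
    by (simp add: nn_integral_cmult shift invB nn_integral_multc)
  finally have eq: "?v B * ?v (f -` A) = ?v B * ?v A" .
  have "?v B \<noteq> \<infinity>"
    unfolding B_def using emeasure_lborel_ball_finite[of "0::'a" 1] by simp
  moreover have "?v B \<noteq> 0"
    using content_ball_pos[of 1 "0::'a"] by (auto simp: B_def measure_def)
  ultimately have "?v (f -` A) = ?v A"
    using eq by (simp add: ennreal_mult_cancel_left)
  then show "emeasure (distr lborel borel f) A = ?v A"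
    by (simp add: emeasure_distr)
qed simp

lemma prod_Basis_vec: "(\<Prod>b\<in>Basis. g b) = (\<Prod>i\<in>UNIV. g (axis i 1))"
  for g :: "real^'n \<Rightarrow> 'b::comm_monoid_mult"
proof -
  have "Basis = (\<lambda>i. axis i (1::real)) ` (UNIV :: 'n set)"
    by (auto simp: Basis_vec_def)
  show ?thesis
    unfolding \<open>Basis = _\<close> by (subst prod.reindex) (simp_all add: inj_on_def axis_eq_axis)
qed

lemma nn_integral_lborel_prod_vec:
  fixes g :: "'n::finite \<Rightarrow> real \<Rightarrow> ennreal"
  assumes [measurable]: "\<And>i. g i \<in> borel_measurable borel"
  shows "(\<integral>\<^sup>+x. (\<Prod>i\<in>UNIV. g i (x $ i)) \<partial>lborel) = (\<Prod>i\<in>UNIV. (\<integral>\<^sup>+y. g i y \<partial>lborel))"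
proof -
  \<comment> \<open>recovers the index from the basis vector\<close>
  define h where "h = (\<lambda>b::real^'n. g (THE i. b = axis i 1))"
  have h: "h (axis i 1) = g i" for i
    by (simp add: h_def axis_eq_axis)
  have "(\<integral>\<^sup>+x. (\<Prod>b\<in>Basis. h b (x \<bullet> b)) \<partial>lborel) = (\<Prod>b\<in>Basis. (\<integral>\<^sup>+y. h b y \<partial>lborel))"
    by (rule nn_integral_lborel_prod) (simp_all add: h_def)
  then show ?thesis
    by (simp add: prod_Basis_vec h inner_axis)
qed

section \<open>The moment generating function of a Gaussian quadratic form\<close>

text \<open>
  Completing the exponent makes the integrand a multiple of the normal density of variance
  \<open>1 / (1 - a)\<close>.
\<close>

lemma std_normal_exp_square_integral:
  assumes "a < 1"
  shows "(\<integral>\<^sup>+y. ennreal (std_normal_density y * exp (a / 2 * (y\<^sup>2 - 1))) \<partial>lborel)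
           = ennreal (exp (- (ln (1 - a) + a) / 2))"
proof -
  define s where "s = 1 / sqrt (1 - a)"
  have s: "s > 0" "s\<^sup>2 = 1 / (1 - a)" using assms by (simp_all add: s_def power_divide)
  have e: "exp (- (ln (1 - a) + a) / 2) = s * exp (- a / 2)"
  proof -
    have "exp (- (ln (1 - a) + a) / 2) = exp (- ln (sqrt (1 - a))) * exp (- a / 2)"
      using assms by (simp add: ln_sqrt add: field_simps flip: exp_add)
    then show ?thesis using assms by (simp add: exp_minus s_def field_simps)
  qed
  have "std_normal_density y * exp (a / 2 * (y\<^sup>2 - 1))
      = exp (- (ln (1 - a) + a) / 2) * normal_density 0 s y" for y
  proof -
    have "std_normal_density y * exp (a / 2 * (y\<^sup>2 - 1))
        = 1 / sqrt (2 * pi) * exp (- y\<^sup>2 / 2 + a / 2 * (y\<^sup>2 - 1))"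
      by (simp add: std_normal_density_def algebra_simps flip: exp_add)
    also have "- y\<^sup>2 / 2 + a / 2 * (y\<^sup>2 - 1) = - a / 2 + - (y - 0)\<^sup>2 / (2 * s\<^sup>2)"
      using assms unfolding s(2) by (simp add: field_simps)
    finally show ?thesis
      using s(1) unfolding e normal_density_def exp_add by (simp add: real_sqrt_mult)
  qed
  then show ?thesis
    using s(1) prob_space.emeasure_space_1[OF prob_space_normal_density, of s 0]
    by (simp add: ennreal_mult' nn_integral_cmult emeasure_density)
qed

text \<open>
  In the rotated coordinates \<open>transpose P *v x\<close> the exponential is a product over the
  coordinates, and so is the density, which a rotation does not change.  Rotation
  invariance and the product formula then leave one-dimensional integrals.
\<close>

lemma gaussian_quadratic_form_mgf:
  fixes d :: "'n::finite \<Rightarrow> real"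
  assumes P: "orthogonal_matrix P" and u: "\<And>i. u * d i < 1"
  defines "A \<equiv> P ** diag_matrix d ** transpose P"
  shows "(\<integral>\<^sup>+x. ennreal (\<Prod>i\<in>UNIV. std_normal_density (x $ i)) *
             ennreal (exp (u / 2 * (x \<bullet> (A *v x) - trace A))) \<partial>lborel)
           = ennreal (exp (\<Sum>i\<in>UNIV. - (ln (1 - u * d i) + u * d i) / 2))"
proof -
  define T where "T = (*v) (transpose P)"
  have T: "orthogonal_transformation T"
    using P by (simp add: T_def orthogonal_transformation_matrix)
  have "linear T" using T by (rule orthogonal_transformation_linear)
  have [measurable]: "T \<in> borel_measurable borel"
    by (intro borel_measurable_continuous_onI linear_continuous_on
        linear_conv_bounded_linear[THEN iffD1] \<open>linear T\<close>)
  define g where "g = (\<lambda>i y. ennreal (std_normal_density y * exp (u * d i / 2 * (y\<^sup>2 - 1))))"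
  have [measurable]: "g i \<in> borel_measurable borel" for i
    unfolding g_def by measurable
  have dens: "(\<Prod>i\<in>UNIV. std_normal_density (x $ i))
      = (1 / sqrt (2 * pi)) ^ CARD('n) * exp (- (norm x)\<^sup>2 / 2)" for x :: "real^'n"
  proof -
    have "(norm x)\<^sup>2 = (\<Sum>i\<in>UNIV. (x $ i)\<^sup>2)"
      unfolding power2_norm_eq_inner by (simp add: inner_vec_def power2_eq_square)
    then show ?thesis
      unfolding std_normal_density_def prod.distrib
      by (simp add: sum_negf flip: exp_sum sum_divide_distrib)
  qed
  have "ennreal (\<Prod>i\<in>UNIV. std_normal_density (x $ i)) *
          ennreal (exp (u / 2 * (x \<bullet> (A *v x) - trace A))) = (\<Prod>i\<in>UNIV. g i (T x $ i))" for x
  proof -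
    have "u / 2 * (x \<bullet> (A *v x) - trace A) = (\<Sum>i\<in>UNIV. u * d i / 2 * ((T x $ i)\<^sup>2 - 1))"
      unfolding A_def quadratic_form_orthogonal_conj_diag trace_orthogonal_conj_diag[OF P] T_def
      by (simp add: sum_distrib_left algebra_simps flip: sum_subtractf)
    moreover have "(\<Prod>i\<in>UNIV. std_normal_density (x $ i)) = (\<Prod>i\<in>UNIV. std_normal_density (T x $ i))"
      unfolding dens by (simp add: orthogonal_transformation_norm[OF T])
    ultimately show ?thesis
      by (simp add: g_def exp_sum prod_ennreal prod.distrib prod_nonneg flip: ennreal_mult)
  qed
  then have "(\<integral>\<^sup>+x. ennreal (\<Prod>i\<in>UNIV. std_normal_density (x $ i)) *
             ennreal (exp (u / 2 * (x \<bullet> (A *v x) - trace A))) \<partial>lborel)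
      = (\<integral>\<^sup>+x. (\<Prod>i\<in>UNIV. g i (T x $ i)) \<partial>lborel)"
    by simp
  also have "\<dots> = (\<integral>\<^sup>+y. (\<Prod>i\<in>UNIV. g i (y $ i)) \<partial>distr lborel borel T)"
    by (subst nn_integral_distr) auto
  also have "\<dots> = (\<Prod>i\<in>UNIV. (\<integral>\<^sup>+y. g i y \<partial>lborel))"
    by (simp add: lborel_distr_orthogonal_transformation[OF T] nn_integral_lborel_prod_vec)
  also have "\<dots> = (\<Prod>i\<in>UNIV. ennreal (exp (- (ln (1 - u * d i) + u * d i) / 2)))"
    unfolding g_def using u by (intro prod.cong refl std_normal_exp_square_integral) auto
  also have "\<dots> = ennreal (exp (\<Sum>i\<in>UNIV. - (ln (1 - u * d i) + u * d i) / 2))"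
    by (simp add: prod_ennreal exp_sum)
  finally show ?thesis .
qed

lemma gaussian_quadratic_form_chernoff:
  fixes d :: "'n::finite \<Rightarrow> real" and X :: "'a \<Rightarrow> real^'n"
  assumes M: "prob_space M" and X: "std_normal_vector M X"
    and P: "orthogonal_matrix P" and u: "u > 0" "\<And>i. u * d i < 1"
  defines "A \<equiv> P ** diag_matrix d ** transpose P"
  shows "measure M {\<omega> \<in> space M. X \<omega> \<bullet> (A *v X \<omega>) - trace A > t}
           \<le> exp ((\<Sum>i\<in>UNIV. - (ln (1 - u * d i) + u * d i) / 2) - u * t / 2)"
proof -
  interpret prob_space M by (rule M)
  have D: "distributed M lborel X (\<lambda>v. ennreal (\<Prod>i\<in>UNIV. std_normal_density (v $ i)))"
    using X by (simp add: std_normal_vector_def)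
  have [measurable]: "X \<in> borel_measurable M"
    using distributed_measurable[OF D] by simp
  define q where "q = (\<lambda>x. x \<bullet> (A *v x) - trace A)"
  have [measurable]: "q \<in> borel_measurable borel"
    unfolding q_def
    by (intro borel_measurable_continuous_onI continuous_intros linear_continuous_on
        linear_conv_bounded_linear[THEN iffD1] matrix_vector_mul_linear)
  let ?I = "exp (\<Sum>i\<in>UNIV. - (ln (1 - u * d i) + u * d i) / 2)"
  have "emeasure M {\<omega> \<in> space M. q (X \<omega>) > t} \<le> emeasure M {\<omega> \<in> space M. q (X \<omega>) \<ge> t}"
    by (intro emeasure_mono) auto
  also have "\<dots> \<le> ennreal (exp (- (u / 2) * t)) *
      (\<integral>\<^sup>+\<omega>. ennreal (exp (u / 2 * q (X \<omega>))) * indicator (space M) \<omega> \<partial>M)"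
    using u by (intro Chernoff_ineq_nn_integral_ge) auto
  also have "(\<integral>\<^sup>+\<omega>. ennreal (exp (u / 2 * q (X \<omega>))) * indicator (space M) \<omega> \<partial>M)
      = (\<integral>\<^sup>+\<omega>. ennreal (exp (u / 2 * q (X \<omega>))) \<partial>M)"
    by (intro nn_integral_cong) auto
  also have "\<dots> = (\<integral>\<^sup>+x. ennreal (\<Prod>i\<in>UNIV. std_normal_density (x $ i)) *
      ennreal (exp (u / 2 * q x)) \<partial>lborel)"
    by (rule distributed_nn_integral[OF D, symmetric]) measurable
  also have "\<dots> = ?I"
    unfolding q_def A_def by (rule gaussian_quadratic_form_mgf[OF P u(2)])
  also have "ennreal (exp (- (u / 2) * t)) * ennreal ?I
      = ennreal (exp ((\<Sum>i\<in>UNIV. - (ln (1 - u * d i) + u * d i) / 2) - u * t / 2))"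
    by (simp add: mult.commute flip: ennreal_mult exp_add)
  finally show ?thesis
    by (simp add: q_def emeasure_eq_measure)
qed

section \<open>Power series estimates for the logarithm\<close>

lemma neg_ln_tail_sums:
  fixes x :: real
  assumes "\<bar>x\<bar> < 1"
  shows "(\<lambda>k. x ^ (k + (m + 1)) / real (k + (m + 1))) sums (- ln (1 - x) - (\<Sum>k=1..m. x ^ k / real k))"
proof -
  have "(\<lambda>n. x ^ n / real n) sums (- ln (1 - x))"
    using sums_minus[OF ln_series'[of "- x"]] assms by simp
  from sums_split_initial_segment[OF this, of "m + 1"]
  have "(\<lambda>k. x ^ (k + (m + 1)) / real (k + (m + 1))) sums (- ln (1 - x) - (\<Sum>k<m + 1. x ^ k / real k))" .
  moreover have "(\<Sum>k<m + 1. x ^ k / real k) = (\<Sum>k=1..m. x ^ k / real k)"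
    by (rule sum.mono_neutral_right) (auto simp: not_le less_Suc_eq_le)
  ultimately show ?thesis by simp
qed

text \<open>
  The series behind \<open>theta\<close>: the tail of the logarithm series from order \<open>m + 1\<close> on, divided by its
  leading power.  Both bounds below on \<open>(m + 1) * theta m b\<close> are read off from it, by comparison
  with its first term and with the geometric series.
\<close>

lemma theta_sums:
  assumes "0 < b" "b < 1"
  shows "(\<lambda>k. b ^ k / real (k + (m + 1))) sums theta m b"
proof -
  have "(\<lambda>k. (1 / b ^ (m + 1)) * (b ^ (k + (m + 1)) / real (k + (m + 1)))) sums
      ((1 / b ^ (m + 1)) * (- ln (1 - b) - (\<Sum>k=1..m. b ^ k / real k)))"
    using assms by (intro sums_mult neg_ln_tail_sums) auto
  moreover have "(1 / b ^ (m + 1)) * (b ^ (k + (m + 1)) / real (k + (m + 1))) = b ^ k / real (k + (m + 1))" for k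
    using assms by (simp add: power_add)
  moreover have "(1 / b ^ (m + 1)) * (- ln (1 - b) - (\<Sum>k=1..m. b ^ k / real k)) = theta m b"
    by (simp add: theta_def algebra_simps)
  ultimately show ?thesis by simp
qed

lemma theta_lower_bound:
  assumes "0 < b" "b < 1"
  shows "1 \<le> (real m + 1) * theta m b"
proof -
  have "(\<Sum>k<1. b ^ k / real (k + (m + 1))) \<le> theta m b"
    unfolding sums_unique[OF theta_sums[OF assms]]
    using assms by (intro sum_le_suminf sums_summable[OF theta_sums]) auto
  then show ?thesis by (simp add: field_simps)
qed

lemma theta_upper_bound:
  assumes "0 < b" "b < 1"
  shows "(real m + 1) * theta m b \<le> 1 / (1 - b)"
proof (rule sums_le)
  show "(\<lambda>k. (real m + 1) * (b ^ k / real (k + (m + 1)))) sums ((real m + 1) * theta m b)"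
    by (intro sums_mult theta_sums assms)
  show "(\<lambda>k. b ^ k) sums (1 / (1 - b))"
    using assms by (intro geometric_sums) auto
  show "(real m + 1) * (b ^ k / real (k + (m + 1))) \<le> b ^ k" for k
    using assms mult_right_mono[of "real m + 1" "real (k + (m + 1))" "b ^ k"]
    by (simp add: field_simps)
qed

text \<open>
  Termwise comparison: in the tail, the excess power \<open>k\<close> of \<open>\<bar>x\<bar>\<close> beyond \<open>m + 1\<close> is bounded by
  \<open>b ^ k\<close>, and what remains is the series of \<open>theta\<close>.
\<close>

lemma neg_ln_taylor_remainder_le:
  fixes x :: real
  assumes x: "\<bar>x\<bar> \<le> b" and b: "0 < b" "b < 1"
  shows "- ln (1 - x) - (\<Sum>k=1..m. x ^ k / real k) \<le> \<bar>x\<bar> ^ (m + 1) * theta m b"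
proof (rule sums_le)
  show "(\<lambda>k. x ^ (k + (m + 1)) / real (k + (m + 1))) sums (- ln (1 - x) - (\<Sum>k=1..m. x ^ k / real k))"
    using x b by (intro neg_ln_tail_sums) auto
  show "(\<lambda>k. \<bar>x\<bar> ^ (m + 1) * (b ^ k / real (k + (m + 1)))) sums (\<bar>x\<bar> ^ (m + 1) * theta m b)"
    by (intro sums_mult theta_sums b)
  show "x ^ (k + (m + 1)) / real (k + (m + 1)) \<le> \<bar>x\<bar> ^ (m + 1) * (b ^ k / real (k + (m + 1)))" for k
  proof -
    have "x ^ (k + (m + 1)) \<le> \<bar>x\<bar> ^ (m + 1) * \<bar>x\<bar> ^ k"
      using abs_ge_self[of "x ^ (k + (m + 1))"] by (simp add: power_abs power_add abs_mult mult_ac)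
    also have "\<dots> \<le> \<bar>x\<bar> ^ (m + 1) * b ^ k"
      using x by (intro mult_left_mono power_mono) auto
    finally show ?thesis by (simp add: divide_right_mono)
  qed
qed

text \<open>
  The contribution of one eigenvalue to the logarithmic moment generating function.  The case
  distinction at zero makes the rank, not the dimension, count the terms when this is summed.
\<close>

lemma centered_log_mgf_le:
  fixes x :: real
  assumes x: "\<bar>x\<bar> \<le> b" and b: "0 < b" "b < 1" and m: "m \<ge> 1"
  shows "- (ln (1 - x) + x) \<le> (if x = 0 then 0 else \<Sum>k=2..m. b ^ k / real k) + \<bar>x\<bar> ^ (m + 1) * theta m b"
proof (cases "x = 0")
  case False
  have "- (ln (1 - x) + x) = (- ln (1 - x) - (\<Sum>k=1..m. x ^ k / real k)) + (\<Sum>k=2..m. x ^ k / real k)"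
    using m by (simp add: sum.atLeast_Suc_atMost numeral_2_eq_2)
  also have "\<dots> \<le> \<bar>x\<bar> ^ (m + 1) * theta m b + (\<Sum>k=2..m. b ^ k / real k)"
  proof (intro add_mono neg_ln_taylor_remainder_le[OF x b] sum_mono divide_right_mono)
    show "x ^ k \<le> b ^ k" for k
      using abs_ge_self[of "x ^ k"] power_mono[OF x, of k] by (simp add: power_abs)
  qed simp
  finally show ?thesis using False by simp
qed simp

lemma powr_inverse_nat_power:
  fixes x :: real
  assumes "x > 0" "m \<ge> 1"
  shows "(x powr (1 / real m)) ^ m = x"
  using assms by (simp add: powr_powr flip: powr_realpow)

section \<open>The tail bound for a fixed truncation order\<close>

lemma log_mgf_sum_le:
  fixes d :: "'n::finite \<Rightarrow> real"
  assumes P: "orthogonal_matrix P" and m: "m \<ge> 1" and b: "0 < b" "b < 1" and u: "u > 0"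
    and ud: "\<And>i. u * \<bar>d i\<bar> \<le> b"
  shows "(\<Sum>i\<in>UNIV. - (ln (1 - u * d i) + u * d i) / 2)
     \<le> real (rank (P ** diag_matrix d ** transpose P)) / 2 * (\<Sum>k=2..m. b ^ k / real k)
        + theta m b * u ^ (m + 1) * (\<Sum>i\<in>UNIV. \<bar>d i\<bar> ^ (m + 1)) / 2"
proof -
  define T where "T = (\<Sum>k=2..m. b ^ k / real k)"
  have "(\<Sum>i\<in>UNIV. - (ln (1 - u * d i) + u * d i) / 2)
      \<le> (\<Sum>i\<in>UNIV. (if d i = 0 then 0 else T / 2) + theta m b * u ^ (m + 1) / 2 * \<bar>d i\<bar> ^ (m + 1))"
  proof (rule sum_mono)
    fix i
    have "- (ln (1 - u * d i) + u * d i)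
        \<le> (if u * d i = 0 then 0 else T) + \<bar>u * d i\<bar> ^ (m + 1) * theta m b"
      unfolding T_def using u ud[of i] by (intro centered_log_mgf_le b m) (simp add: abs_mult)
    moreover have "\<bar>u * d i\<bar> ^ (m + 1) = u ^ (m + 1) * \<bar>d i\<bar> ^ (m + 1)"
      using u by (simp only: abs_mult power_mult_distrib abs_of_pos)
    ultimately show "- (ln (1 - u * d i) + u * d i) / 2
        \<le> (if d i = 0 then 0 else T / 2) + theta m b * u ^ (m + 1) / 2 * \<bar>d i\<bar> ^ (m + 1)"
      using u by (simp add: mult_ac split: if_splits)
  qed
  also have "\<dots> = (\<Sum>i\<in>UNIV. (if d i = 0 then 0 else T / 2))
        + theta m b * u ^ (m + 1) / 2 * (\<Sum>i\<in>UNIV. \<bar>d i\<bar> ^ (m + 1))"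
    by (simp only: sum.distrib sum_distrib_left)
  also have "(\<Sum>i\<in>UNIV. (if d i = 0 then 0 else T / 2)) = real (card {i. d i \<noteq> 0}) * (T / 2)"
    by (subst sum.If_cases) (auto simp: Collect_neg_eq)
  finally show ?thesis
    by (simp add: rank_orthogonal_conj[OF P] rank_diag_matrix T_def)
qed

text \<open>
  With \<open>c\<close> and \<open>\<alpha>\<close> as in the proof, \<open>c * \<alpha>\<close> is the unconstrained minimizer of
  \<open>theta m b * u ^ (m + 1) * S - u * t\<close>, whose derivative vanishes when
  \<open>(m + 1) * theta m b * u ^ m * S = t\<close>.  The cap \<open>b / L\<close> keeps every \<open>u * d i\<close> in the range where
  the series estimate is valid.  Finally, \<open>u * t\<close> is the smaller of \<open>c * (t * \<alpha>)\<close> and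
  \<open>b * (t / L)\<close>, hence at least the product of the minima \<open>min c b\<close>, from \<open>kappa\<close>, and
  \<open>min (t * \<alpha>) (t / L)\<close>, from \<open>Lambda\<close>.
\<close>

lemma tail_le_exp_Lambda:
  fixes d :: "'n::finite \<Rightarrow> real" and X :: "'a \<Rightarrow> real^'n"
  assumes M: "prob_space M" and X: "std_normal_vector M X"
    and P: "orthogonal_matrix P" and nz: "d j \<noteq> 0"
    and m: "m \<ge> 1" and b: "0 < b" "b < 1" and t: "t > 0"
  defines "A \<equiv> P ** diag_matrix d ** transpose P"
  shows "measure M {\<omega> \<in> space M. X \<omega> \<bullet> (A *v X \<omega>) - trace A > t} \<le> exp (Lambda A m t b)"
proof -
  define L where "L = op_norm A"
  define S where "S = (\<Sum>i\<in>UNIV. \<bar>d i\<bar> ^ (m + 1))"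
  define Q where "Q = (real m + 1) * theta m b"
  define c where "c = 1 / Q powr (1 / real m)"
  define \<alpha> where "\<alpha> = t powr (1 / real m) / S powr (1 / real m)"
  define u where "u = min (c * \<alpha>) (b / L)"
  have dL: "\<bar>d i\<bar> \<le> L" for i
    unfolding L_def A_def by (rule abs_eigenvalue_le_op_norm[OF P])
  have L: "L > 0" using dL[of j] nz by linarith
  have S: "S > 0"
    unfolding S_def by (rule sum_pos2[of UNIV j]) (use nz in auto)
  have Q: "Q > 0"
    using theta_lower_bound[OF b, of m] by (simp add: Q_def)
  have c: "c > 0" and \<alpha>: "\<alpha> > 0"
    using Q S t by (simp_all add: c_def \<alpha>_def)
  have u: "u > 0" using c \<alpha> b L by (simp add: u_def)
  have ud: "u * \<bar>d i\<bar> \<le> b" for i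
  proof -
    have "u * \<bar>d i\<bar> \<le> (b / L) * L"
      using dL[of i] b L by (intro mult_mono) (auto simp: u_def)
    then show ?thesis using L by simp
  qed
  have ud1: "u * d i < 1" for i
    using ud[of i] b mult_left_mono[OF abs_ge_self[of "d i"], of u] u by linarith
  \<comment> \<open>up to the minimizer, the term with \<open>theta\<close> costs at most the share \<open>1 / (m + 1)\<close> of the linear gain\<close>
  have opt: "theta m b * u ^ (m + 1) * S \<le> u * t / (real m + 1)"
  proof -
    have "u ^ m \<le> (c * \<alpha>) ^ m"
      using u by (intro power_mono) (auto simp: u_def)
    also have "\<dots> = t / (Q * S)"
      using Q S t m
      by (simp add: c_def \<alpha>_def power_mult_distrib power_divide powr_inverse_nat_power)
    finally have "Q * S * u ^ m \<le> t"
      using Q S by (simp add: field_simps)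
    then have "(Q * S * u ^ m) * u \<le> t * u"
      using u by (intro mult_right_mono) auto
    then show ?thesis
      by (simp add: Q_def field_simps)
  qed
  have gain: "kappa m b * min (t powr (1 + 1 / real m) / schatten_norm (real m + 1) A powr (1 + 1 / real m))
           (t / L) \<le> real m / (2 * (real m + 1)) * (u * t)"
  proof -
    have \<alpha>': "t powr (1 + 1 / real m) / schatten_norm (real m + 1) A powr (1 + 1 / real m) = t * \<alpha>"
      unfolding A_def schatten_norm_orthogonal_conj_diag[OF P m] S_def[symmetric] \<alpha>_def
      using t by (simp add: powr_add)
    have "min c b * min (t * \<alpha>) (t / L) \<le> u * t"
    proof -
      have "min c b * min (t * \<alpha>) (t / L) \<le> c * (t * \<alpha>)"
        using c \<alpha> b t L by (intro mult_mono) auto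
      moreover have "min c b * min (t * \<alpha>) (t / L) \<le> b * (t / L)"
        using c \<alpha> b t L by (intro mult_mono) auto
      ultimately show ?thesis
        unfolding u_def by (simp add: min_def mult_ac)
    qed
    then have "real m / (2 * (real m + 1)) * (min c b * min (t * \<alpha>) (t / L))
        \<le> real m / (2 * (real m + 1)) * (u * t)"
      by (intro mult_left_mono) auto
    then show ?thesis
      unfolding kappa_def \<alpha>' by (simp only: c_def Q_def mult.assoc)
  qed
  have "(\<Sum>i\<in>UNIV. - (ln (1 - u * d i) + u * d i) / 2) - u * t / 2
      \<le> real (rank A) / 2 * (\<Sum>k=2..m. b ^ k / real k) + u * t / (real m + 1) / 2 - u * t / 2"
  proof -
    have "x - w \<le> y + z / 2 - w" if "x \<le> y + v / 2" "v \<le> z" for v w x y z :: real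
      using that by linarith
    from this[OF log_mgf_sum_le[where d = d, OF P m b u ud, folded A_def S_def] opt]
    show ?thesis .
  qed
  also have "\<dots> = real (rank A) / 2 * (\<Sum>k=2..m. b ^ k / real k) - real m / (2 * (real m + 1)) * (u * t)"
    by (simp add: field_simps)
  also have "\<dots> \<le> Lambda A m t b"
    using gain by (simp add: Lambda_def L_def)
  finally have "exp ((\<Sum>i\<in>UNIV. - (ln (1 - u * d i) + u * d i) / 2) - u * t / 2) \<le> exp (Lambda A m t b)"
    by simp
  then show ?thesis
    using gaussian_quadratic_form_chernoff[OF M X P u ud1, of t] unfolding A_def
    by (rule order_trans[rotated])
qed

section \<open>The limit of the exponents\<close>

text \<open>
  An upper bound for the exponent in which the two quantities depending on \<open>m\<close> in a complicated
  way are made explicit: \<open>theta\<close> is replaced by its geometric series bound, and the Schatten norm by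
  the operator norm at the cost of a power of the dimension that tends to 1.
\<close>

lemma Lambda_le:
  fixes d :: "'n::finite \<Rightarrow> real"
  assumes P: "orthogonal_matrix P" and nz: "d j \<noteq> 0"
    and m: "m \<ge> 1" and b: "0 < b" "b < 1" and t: "t > 0"
  defines "A \<equiv> P ** diag_matrix d ** transpose P"
  shows "Lambda A m t b \<le> real (rank A) / 2 * (\<Sum>k=2..m. b ^ k / real k)
      - real m / (2 * (real m + 1)) * min ((1 - b) powr (1 / real m)) b *
        min (t powr (1 + 1 / real m) / (real CARD('n) powr (1 / real m) * op_norm A powr (1 + 1 / real m)))
            (t / op_norm A)"
proof -
  define L where "L = op_norm A"
  define S where "S = (\<Sum>i\<in>UNIV. \<bar>d i\<bar> ^ (m + 1))"
  define Q where "Q = (real m + 1) * theta m b"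
  have dL: "\<bar>d i\<bar> \<le> L" for i
    unfolding L_def A_def by (rule abs_eigenvalue_le_op_norm[OF P])
  have L: "L > 0" using dL[of j] nz by linarith
  have S: "S > 0"
    unfolding S_def by (rule sum_pos2[of UNIV j]) (use nz in auto)
  have Q: "Q > 0" "Q \<le> 1 / (1 - b)"
    using theta_lower_bound[OF b, of m] theta_upper_bound[OF b, of m] by (simp_all add: Q_def)
  have "Q powr (1 / real m) \<le> (1 / (1 - b)) powr (1 / real m)"
    using Q by (intro powr_mono2) auto
  then have "1 / (1 / (1 - b)) powr (1 / real m) \<le> 1 / Q powr (1 / real m)"
    using Q b by (intro divide_left_mono) auto
  then have c: "(1 - b) powr (1 / real m) \<le> 1 / Q powr (1 / real m)"
    using b by (simp add: powr_divide)
  have "S \<le> real CARD('n) * L ^ (m + 1)"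
    unfolding S_def using dL by (intro sum_bounded_above power_mono) auto
  then have "S powr (1 / real m) \<le> (real CARD('n) * L ^ (m + 1)) powr (1 / real m)"
    using S by (intro powr_mono2) auto
  also have "\<dots> = real CARD('n) powr (1 / real m) * L powr (1 + 1 / real m)"
  proof -
    have "(real m + 1) * (1 / real m) = 1 + 1 / real m"
      using m by (simp add: field_simps)
    moreover have "L ^ (m + 1) = L powr (real m + 1)"
      using L powr_realpow[of L "m + 1"] by (simp add: add.commute)
    ultimately show ?thesis
      using L by (simp add: powr_mult powr_powr)
  qed
  finally have N: "t powr (1 + 1 / real m) / (real CARD('n) powr (1 / real m) * L powr (1 + 1 / real m))
      \<le> t powr (1 + 1 / real m) / S powr (1 / real m)"
    using S t L by (intro divide_left_mono) auto
  have "min ((1 - b) powr (1 / real m)) b *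
        min (t powr (1 + 1 / real m) / (real CARD('n) powr (1 / real m) * L powr (1 + 1 / real m))) (t / L)
     \<le> min (1 / Q powr (1 / real m)) b * min (t powr (1 + 1 / real m) / S powr (1 / real m)) (t / L)"
    using c N b t L by (intro mult_mono) auto
  then have "real m / (2 * (real m + 1)) * (min ((1 - b) powr (1 / real m)) b *
        min (t powr (1 + 1 / real m) / (real CARD('n) powr (1 / real m) * L powr (1 + 1 / real m))) (t / L))
     \<le> real m / (2 * (real m + 1)) * (min (1 / Q powr (1 / real m)) b *
        min (t powr (1 + 1 / real m) / S powr (1 / real m)) (t / L))"
    by (intro mult_left_mono) auto
  moreover have "schatten_norm (real m + 1) A powr (1 + 1 / real m) = S powr (1 / real m)"
    unfolding A_def S_def by (rule schatten_norm_orthogonal_conj_diag[OF P m])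
  ultimately show ?thesis
    unfolding Lambda_def kappa_def by (simp only: L_def Q_def mult.assoc)
qed

lemma log_series_from_2_limit:
  fixes b :: real
  assumes "0 < b" "b < 1"
  shows "(\<lambda>m. \<Sum>k=2..m. b ^ k / real k) \<longlonglongrightarrow> - ln (1 - b) - b"
proof -
  have "(\<lambda>k. b ^ (k + 2) / real (k + 2)) sums (- ln (1 - b) - b)"
    using neg_ln_tail_sums[of b 1] assms by simp
  then have "(\<lambda>n. \<Sum>k<n. b ^ (k + 2) / real (k + 2)) \<longlonglongrightarrow> - ln (1 - b) - b"
    by (simp add: sums_def)
  moreover have "(\<Sum>k<n. b ^ (k + 2) / real (k + 2)) = (\<Sum>k=2..n + 1. b ^ k / real k)" for n
    by (rule sum.reindex_bij_witness[of _ "\<lambda>k. k - 2" "\<lambda>k. k + 2"]) auto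
  ultimately have "(\<lambda>n. \<Sum>k=2..n + 1. b ^ k / real k) \<longlonglongrightarrow> - ln (1 - b) - b"
    by simp
  from this[unfolded Suc_eq_plus1[symmetric]] show ?thesis
    by (rule LIMSEQ_imp_Suc)
qed

lemma exp_Lambda_bound_limit:
  fixes n r L t b :: real
  assumes b: "0 < b" "b < 1" and "n > 0" "L > 0" "t > 0"
  shows "(\<lambda>m. r / 2 * (\<Sum>k=2..m. b ^ k / real k)
      - real m / (2 * (real m + 1)) * min ((1 - b) powr (1 / real m)) b *
        min (t powr (1 + 1 / real m) / (n powr (1 / real m) * L powr (1 + 1 / real m))) (t / L))
     \<longlonglongrightarrow> r / 2 * (- ln (1 - b) - b) - b * t / (2 * L)"
proof -
  have inv: "(\<lambda>m. 1 / real m) \<longlonglongrightarrow> 0"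
    by (rule lim_1_over_n)
  have half: "(\<lambda>m. real m / (2 * (real m + 1))) \<longlonglongrightarrow> 1 / 2"
    by real_asymp
  have "(\<lambda>m. r / 2 * (\<Sum>k=2..m. b ^ k / real k)
      - real m / (2 * (real m + 1)) * min ((1 - b) powr (1 / real m)) b *
        min (t powr (1 + 1 / real m) / (n powr (1 / real m) * L powr (1 + 1 / real m))) (t / L))
     \<longlonglongrightarrow> r / 2 * (- ln (1 - b) - b) - 1 / 2 * min ((1 - b) powr 0) b *
        min (t powr (1 + 0) / (n powr 0 * L powr (1 + 0))) (t / L)"
    using assms by (intro tendsto_intros log_series_from_2_limit half inv) auto
  then show ?thesis using assms by simp
qed

text \<open>
  At this \<open>b\<close> one has \<open>1 - b = 1 / (1 + t / (r * L))\<close>, while the two terms linear in \<open>b\<close> add up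
  to \<open>t / (2 * L)\<close>.
\<close>

lemma optimized_exponent:
  fixes r L t b :: real
  assumes "r > 0" "L > 0" "t > 0"
  defines "b \<equiv> t / (r * L + t)"
  shows "exp (r / 2 * (- ln (1 - b) - b) - b * t / (2 * L)) = (1 + t / (r * L)) powr (r / 2) * exp (- t / (2 * L))"
proof -
  have pos: "r * L + t > 0" using assms by (simp add: add_pos_pos)
  have "1 - b = 1 / (1 + t / (r * L))"
    using assms(1-3) pos by (simp add: b_def field_simps)
  moreover have pos': "1 + t / (r * L) > 0" using assms(1-3) by (simp add: add_pos_pos)
  ultimately have "- ln (1 - b) = ln (1 + t / (r * L))"
    by (simp add: ln_div)
  moreover have "r / 2 * b + b * t / (2 * L) = t / (2 * L)"
  proof -
    have "r / 2 * b + b * t / (2 * L) = b * (r * L + t) / (2 * L)"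
      using assms(2) by (simp add: field_simps)
    then show ?thesis using pos by (simp add: b_def)
  qed
  ultimately have "r / 2 * (- ln (1 - b) - b) - b * t / (2 * L) = r / 2 * ln (1 + t / (r * L)) + - t / (2 * L)"
    by (simp add: algebra_simps)
  then show ?thesis using pos' by (simp only: exp_add) (simp add: powr_def)
qed

section \<open>The two inequalities\<close>

theorem corollary1:
  fixes A :: "real^'n^'n" and M :: "'a measure" and X :: "'a \<Rightarrow> real^'n" and t :: real
  assumes "transpose A = A" and "A \<noteq> 0"
    and "prob_space M" and "std_normal_vector M X"
    and "t > 0"
  shows "ereal (measure M {\<omega> \<in> space M. X \<omega> \<bullet> (A *v X \<omega>) - trace A > t})
           \<le> liminf (\<lambda>m. INF b\<in>{0<..<1}. ereal (exp (Lambda A m t b)))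
       \<and> liminf (\<lambda>m. INF b\<in>{0<..<1}. ereal (exp (Lambda A m t b)))
           \<le> ereal ((1 + t / (real (rank A) * op_norm A)) powr (real (rank A) / 2) *
                     exp (- t / (2 * op_norm A)))"
proof -
  obtain P d where P: "orthogonal_matrix P" and A: "A = P ** diag_matrix d ** transpose P"
    using symmetric_matrix_diagonalization[OF assms(1)] .
  have "rank A > 0" using assms(2) rank_eq_0[of A] by simp
  then have "card {i. d i \<noteq> 0} > 0"
    by (simp add: A rank_orthogonal_conj[OF P] rank_diag_matrix)
  then obtain j where j: "d j \<noteq> 0" by (auto simp: card_gt_0_iff)
  have L: "op_norm A > 0"
    using abs_eigenvalue_le_op_norm[OF P, of d j] j unfolding A by linarith
  define r where "r = real (rank A)"
  have r: "r > 0" using \<open>rank A > 0\<close> by (simp add: r_def)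
  \<comment> \<open>the minimizer of the limiting exponent\<close>
  define b where "b = t / (r * op_norm A + t)"
  have b: "0 < b" "b < 1"
    using r L assms(5) by (auto simp: b_def add_pos_pos field_simps)
  define U where "U = (\<lambda>m. real (rank A) / 2 * (\<Sum>k=2..m. b ^ k / real k)
      - real m / (2 * (real m + 1)) * min ((1 - b) powr (1 / real m)) b *
        min (t powr (1 + 1 / real m) / (real CARD('n) powr (1 / real m) * op_norm A powr (1 + 1 / real m)))
            (t / op_norm A))"
  have "liminf (\<lambda>m. INF b\<in>{0<..<1}. ereal (exp (Lambda A m t b))) \<le> liminf (\<lambda>m. ereal (exp (U m)))"
  proof (rule Liminf_mono)
    show "\<forall>\<^sub>F m in sequentially. (INF b\<in>{0<..<1}. ereal (exp (Lambda A m t b))) \<le> ereal (exp (U m))"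
      using eventually_ge_at_top[of 1]
    proof eventually_elim
      case (elim m)
      have "(INF b\<in>{0<..<1}. ereal (exp (Lambda A m t b))) \<le> ereal (exp (Lambda A m t b))"
        using b by (intro INF_lower) auto
      also have "\<dots> \<le> ereal (exp (U m))"
        using Lambda_le[where d = d and j = j, OF P j elim b assms(5)] by (simp add: U_def A)
      finally show ?case .
    qed
  qed
  also have "liminf (\<lambda>m. ereal (exp (U m))) = ereal (exp (r / 2 * (- ln (1 - b) - b) - b * t / (2 * op_norm A)))"
    unfolding U_def r_def
    using b L assms(5)
    by (intro lim_imp_Liminf tendsto_ereal tendsto_exp exp_Lambda_bound_limit) auto
  also have "exp (r / 2 * (- ln (1 - b) - b) - b * t / (2 * op_norm A))
      = (1 + t / (r * op_norm A)) powr (r / 2) * exp (- t / (2 * op_norm A))"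
    unfolding b_def by (rule optimized_exponent[OF r L assms(5)])
  finally have upper: "liminf (\<lambda>m. INF b\<in>{0<..<1}. ereal (exp (Lambda A m t b)))
      \<le> ereal ((1 + t / (r * op_norm A)) powr (r / 2) * exp (- t / (2 * op_norm A)))" .
  have "ereal (measure M {\<omega> \<in> space M. X \<omega> \<bullet> (A *v X \<omega>) - trace A > t})
      \<le> liminf (\<lambda>m. INF b\<in>{0<..<1}. ereal (exp (Lambda A m t b)))"
  proof (rule Liminf_bounded)
    show "\<forall>\<^sub>F m in sequentially. ereal (measure M {\<omega> \<in> space M. X \<omega> \<bullet> (A *v X \<omega>) - trace A > t})
        \<le> (INF b\<in>{0<..<1}. ereal (exp (Lambda A m t b)))"
      using eventually_ge_at_top[of 1]
    proof eventually_elim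
      case (elim m)
      show ?case
        using tail_le_exp_Lambda[where d = d, OF assms(3,4) P j elim _ _ assms(5)]
        by (intro INF_greatest) (auto simp: A)
    qed
  qed
  with upper show ?thesis by (simp add: r_def)
qed

end
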